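(* Let $R$ be a semiring with a negation map which has a lift. Then every $R$-module has a lift which is a free module. Furthermore, if an $R$-module $M$ is generated by $\mu$ elements (for some cardinal number $\mu$), then $M$ possesses a lift which is a free module generated by $\mu$ elements (i.e. for some lift $(\widehat R,\widehat\varphi)$ of $R$, there is a lift $(\widehat M,\widehat\psi)$ of $M$ with $\widehat M$ a free $\widehat R$-module on $\mu$ generators).
   Context: A semiring $R$ has $0_R$ (absorbing additive identity) and $1_R$. A negation map on $R$ is a map $(-):R\to R$ with $(-)(a+b)=(-)a+(-)b$, $(-)0_R=0_R$, $(-)(ab)=a((-)b)=((-)a)b$, $(-)((-)a)=a$. An $R$-module is a commutative monoid $(M,+,0_M)$ with a unital, associative, biadditive scalar multiplication satisfying $\alpha 0_M=0_M$, $0_Rx=0_M$; it carries the induced negation map $(-)x=((-)1_R)x$. Write $a^\circ=a+(-)a$, $R^\circ=\{a^\circ: a\in R\}$, $R^\vee=(R\setminus R^\circ)\cup\{0_R\}$, $M^\circ=\{x+(-)x: x\in M\}$. The surpassing relation (on $R$ or on $M$) is $x\succeq y$ iff $x=y+z$ for some $z\in R^\circ$ (resp. $z\in M^\circ$); $y\preceq x$ means $x\succeq y$. A subset $A$ of $R$ (resp. of $M$) is $\preceq$-dense if every element $\beta$ of $R$ (resp. $M$) satisfies $\beta\succeq\alpha$ for some $\alpha\in A$. A $\preceq$-morphism of semirings with negation maps is a map $\varphi:R_1\to R_2$ with $\varphi(\alpha+\beta)\preceq\varphi(\alpha)+\varphi(\beta)$, $\varphi(\alpha\beta)\preceq\varphi(\alpha)\varphi(\beta)$,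 $\varphi((-)\alpha)=(-)\varphi(\alpha)$, $\varphi(0)=0$, $\varphi(1)=1$. A lift of $R$ is a ring $\widehat R$ with a map $\widehat\varphi:\widehat R\to R$ such that: (1) $\widehat\varphi$ is a $\preceq$-morphism, where $\widehat R$ has negation map $(-)\widehat\alpha=-\widehat\alpha$; (2) $\operatorname{Im}\widehat\varphi\subseteq R^\vee$ and $\operatorname{Im}\widehat\varphi$ is $\preceq$-dense in $R$; (3) $\widehat\varphi(\widehat\alpha)=0_R\iff\widehat\alpha=0_{\widehat R}$. Given a lift $(\widehat R,\widehat\varphi)$ of $R$, a lift of an $R$-module $M$ is an $\widehat R$-module $\widehat M$ with a map $\widehat\psi:\widehat M\to M$ such that: (1) $\widehat\psi(x_1)+\widehat\psi(x_2)\succeq\widehat\psi(x_1+x_2)$ for all $x_1,x_2\in\widehat M$; (2) $\widehat\varphi(\widehat\alpha)\widehat\psi(x)\succeq\widehat\psi(\widehat\alpha x)$ for all $\widehat\alpha\in\widehat R$, $x\in\widehat M$; (3) $\widehat\psi(0_{\widehat M})=0_M$; (4) $\operatorname{Im}\widehat\psi$ is $\preceq$-dense in $M$. *)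

theory Defs
  imports "HOL-Algebra.Algebra"
begin

locale semiring_negation = semiring R for R (structure) +
  fixes neg :: "'a \<Rightarrow> 'a"
  assumes neg_closed: "a \<in> carrier R \<Longrightarrow> neg a \<in> carrier R"
    and neg_add: "\<lbrakk>a \<in> carrier R; b \<in> carrier R\<rbrakk> \<Longrightarrow> neg (a \<oplus> b) = neg a \<oplus> neg b"
    and neg_zero: "neg \<zero> = \<zero>"
    and neg_mult_r: "\<lbrakk>a \<in> carrier R; b \<in> carrier R\<rbrakk> \<Longrightarrow> neg (a \<otimes> b) = a \<otimes> neg b"
    and neg_mult_l: "\<lbrakk>a \<in> carrier R; b \<in> carrier R\<rbrakk> \<Longrightarrow> neg (a \<otimes> b) = neg a \<otimes> b"
    and neg_neg: "a \<in> carrier R \<Longrightarrow> neg (neg a) = a"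

text \<open>
  Left modules over a not necessarily commutative semiring. The library locale \<open>module\<close>
  requires a commutative ring and an additive group, so only its record type is reused; the
  multiplication and unit of that record on the module side play no role.
  When \<open>R\<close> is a ring this is the usual notion of a left module, since
  \<open>(\<ominus> \<one>) \<odot> x\<close> is then an additive inverse of \<open>x\<close>.
\<close>

locale semimodule = R?: semiring R + M?: abelian_monoid M
  for R (structure) and M (structure) +
  assumes smult_closed: "\<lbrakk>a \<in> carrier R; x \<in> carrier M\<rbrakk> \<Longrightarrow> a \<odot>\<^bsub>M\<^esub> x \<in> carrier M"
    and smult_l_distr: "\<lbrakk>a \<in> carrier R; b \<in> carrier R; x \<in> carrier M\<rbrakk> \<Longrightarrow>
      (a \<oplus> b) \<odot>\<^bsub>M\<^esub> x = a \<odot>\<^bsub>M\<^esub> x \<oplus>\<^bsub>M\<^esub> b \<odot>\<^bsub>M\<^esub> x"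
    and smult_r_distr: "\<lbrakk>a \<in> carrier R; x \<in> carrier M; y \<in> carrier M\<rbrakk> \<Longrightarrow>
      a \<odot>\<^bsub>M\<^esub> (x \<oplus>\<^bsub>M\<^esub> y) = a \<odot>\<^bsub>M\<^esub> x \<oplus>\<^bsub>M\<^esub> a \<odot>\<^bsub>M\<^esub> y"
    and smult_assoc: "\<lbrakk>a \<in> carrier R; b \<in> carrier R; x \<in> carrier M\<rbrakk> \<Longrightarrow>
      (a \<otimes> b) \<odot>\<^bsub>M\<^esub> x = a \<odot>\<^bsub>M\<^esub> (b \<odot>\<^bsub>M\<^esub> x)"
    and smult_one: "x \<in> carrier M \<Longrightarrow> \<one> \<odot>\<^bsub>M\<^esub> x = x"
    and smult_zero_r: "a \<in> carrier R \<Longrightarrow> a \<odot>\<^bsub>M\<^esub> \<zero>\<^bsub>M\<^esub> = \<zero>\<^bsub>M\<^esub>"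
    and smult_zero_l: "x \<in> carrier M \<Longrightarrow> \<zero> \<odot>\<^bsub>M\<^esub> x = \<zero>\<^bsub>M\<^esub>"

definition induced_neg ::
    "('a, 'r) ring_scheme \<Rightarrow> ('a \<Rightarrow> 'a) \<Rightarrow> ('a, 'b, 'm) module_scheme \<Rightarrow> 'b \<Rightarrow> 'b" where
  "induced_neg R neg M x = neg \<one>\<^bsub>R\<^esub> \<odot>\<^bsub>M\<^esub> x"

text \<open>
  The next three definitions use only the additive structure of \<open>S\<close>, so they apply both to
  semirings and, with the induced negation map, to modules.
\<close>

definition circ :: "('a, 'x) ring_scheme \<Rightarrow> ('a \<Rightarrow> 'a) \<Rightarrow> 'a set" where
  "circ S neg = {a \<oplus>\<^bsub>S\<^esub> neg a | a. a \<in> carrier S}"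

definition surpasses :: "('a, 'x) ring_scheme \<Rightarrow> ('a \<Rightarrow> 'a) \<Rightarrow> 'a \<Rightarrow> 'a \<Rightarrow> bool" where
  "surpasses S neg x y \<longleftrightarrow> (\<exists>z \<in> circ S neg. x = y \<oplus>\<^bsub>S\<^esub> z)"

definition surpass_dense :: "('a, 'x) ring_scheme \<Rightarrow> ('a \<Rightarrow> 'a) \<Rightarrow> 'a set \<Rightarrow> bool" where
  "surpass_dense S neg A \<longleftrightarrow>
     A \<subseteq> carrier S \<and> (\<forall>\<beta> \<in> carrier S. \<exists>\<alpha> \<in> A. surpasses S neg \<beta> \<alpha>)"

definition vee :: "('a, 'r) ring_scheme \<Rightarrow> ('a \<Rightarrow> 'a) \<Rightarrow> 'a set" where
  "vee R neg = (carrier R - circ R neg) \<union> {\<zero>\<^bsub>R\<^esub>}"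

definition surpass_morphism ::
    "('a, 'r) ring_scheme \<Rightarrow> ('a \<Rightarrow> 'a) \<Rightarrow> ('b, 's) ring_scheme \<Rightarrow> ('b \<Rightarrow> 'b) \<Rightarrow> ('a \<Rightarrow> 'b) \<Rightarrow> bool"
  where
  "surpass_morphism R1 neg1 R2 neg2 \<phi> \<longleftrightarrow>
     \<phi> \<in> carrier R1 \<rightarrow> carrier R2 \<and>
     (\<forall>\<alpha> \<in> carrier R1. \<forall>\<beta> \<in> carrier R1.
        surpasses R2 neg2 (\<phi> \<alpha> \<oplus>\<^bsub>R2\<^esub> \<phi> \<beta>) (\<phi> (\<alpha> \<oplus>\<^bsub>R1\<^esub> \<beta>))) \<and>
     (\<forall>\<alpha> \<in> carrier R1. \<forall>\<beta> \<in> carrier R1.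
        surpasses R2 neg2 (\<phi> \<alpha> \<otimes>\<^bsub>R2\<^esub> \<phi> \<beta>) (\<phi> (\<alpha> \<otimes>\<^bsub>R1\<^esub> \<beta>))) \<and>
     (\<forall>\<alpha> \<in> carrier R1. \<phi> (neg1 \<alpha>) = neg2 (\<phi> \<alpha>)) \<and>
     \<phi> \<zero>\<^bsub>R1\<^esub> = \<zero>\<^bsub>R2\<^esub> \<and>
     \<phi> \<one>\<^bsub>R1\<^esub> = \<one>\<^bsub>R2\<^esub>"

definition semiring_lift ::
    "('a, 'r) ring_scheme \<Rightarrow> ('a \<Rightarrow> 'a) \<Rightarrow> ('h, 's) ring_scheme \<Rightarrow> ('h \<Rightarrow> 'a) \<Rightarrow> bool" where
  "semiring_lift R neg Rh \<phi> \<longleftrightarrow>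
     ring Rh \<and>
     surpass_morphism Rh (a_inv Rh) R neg \<phi> \<and>
     \<phi> ` carrier Rh \<subseteq> vee R neg \<and>
     surpass_dense R neg (\<phi> ` carrier Rh) \<and>
     (\<forall>\<alpha> \<in> carrier Rh. \<phi> \<alpha> = \<zero>\<^bsub>R\<^esub> \<longleftrightarrow> \<alpha> = \<zero>\<^bsub>Rh\<^esub>)"

definition module_lift ::
    "('a, 'r) ring_scheme \<Rightarrow> ('a \<Rightarrow> 'a) \<Rightarrow> ('h, 's) ring_scheme \<Rightarrow> ('h \<Rightarrow> 'a) \<Rightarrow>
     ('a, 'b, 'm) module_scheme \<Rightarrow> ('h, 'c, 'n) module_scheme \<Rightarrow> ('c \<Rightarrow> 'b) \<Rightarrow> bool" where
  "module_lift R neg Rh \<phi> M Mh \<psi> \<longleftrightarrow>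
     semimodule Rh Mh \<and>
     \<psi> \<in> carrier Mh \<rightarrow> carrier M \<and>
     (\<forall>x \<in> carrier Mh. \<forall>y \<in> carrier Mh.
        surpasses M (induced_neg R neg M) (\<psi> x \<oplus>\<^bsub>M\<^esub> \<psi> y) (\<psi> (x \<oplus>\<^bsub>Mh\<^esub> y))) \<and>
     (\<forall>\<alpha> \<in> carrier Rh. \<forall>x \<in> carrier Mh.
        surpasses M (induced_neg R neg M) (\<phi> \<alpha> \<odot>\<^bsub>M\<^esub> \<psi> x) (\<psi> (\<alpha> \<odot>\<^bsub>Mh\<^esub> x))) \<and>
     \<psi> \<zero>\<^bsub>Mh\<^esub> = \<zero>\<^bsub>M\<^esub> \<and>
     surpass_dense M (induced_neg R neg M) (\<psi> ` carrier Mh)"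

definition generating_family ::
    "('a, 'r) ring_scheme \<Rightarrow> ('a, 'b, 'm) module_scheme \<Rightarrow> 'i set \<Rightarrow> ('i \<Rightarrow> 'b) \<Rightarrow> bool" where
  "generating_family R M I g \<longleftrightarrow>
     g \<in> I \<rightarrow> carrier M \<and>
     (\<forall>x \<in> carrier M. \<exists>A c. finite A \<and> A \<subseteq> I \<and> c \<in> A \<rightarrow> carrier R \<and>
        x = (\<Oplus>\<^bsub>M\<^esub>i\<in>A. c i \<odot>\<^bsub>M\<^esub> g i))"

text \<open>Used only for modules over a ring.\<close>

definition independent_family ::
    "('a, 'r) ring_scheme \<Rightarrow> ('a, 'b, 'm) module_scheme \<Rightarrow> 'i set \<Rightarrow> ('i \<Rightarrow> 'b) \<Rightarrow> bool" where
  "independent_family R M I e \<longleftrightarrow>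
     e \<in> I \<rightarrow> carrier M \<and>
     (\<forall>A c. finite A \<and> A \<subseteq> I \<and> c \<in> A \<rightarrow> carrier R \<and>
        (\<Oplus>\<^bsub>M\<^esub>i\<in>A. c i \<odot>\<^bsub>M\<^esub> e i) = \<zero>\<^bsub>M\<^esub> \<longrightarrow> (\<forall>i \<in> A. c i = \<zero>\<^bsub>R\<^esub>))"

definition basis_family ::
    "('a, 'r) ring_scheme \<Rightarrow> ('a, 'b, 'm) module_scheme \<Rightarrow> 'i set \<Rightarrow> ('i \<Rightarrow> 'b) \<Rightarrow> bool" where
  "basis_family R M I e \<longleftrightarrow> generating_family R M I e \<and> independent_family R M I e"

definition free_module ::
    "('a, 'r) ring_scheme \<Rightarrow> ('a, 'b, 'm) module_scheme \<Rightarrow> bool" where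
  "free_module R M \<longleftrightarrow> (\<exists>B. basis_family R M B (\<lambda>b. b))"

text \<open>
  A cardinal number is represented, as in the library, by a relation \<open>\<mu>\<close> with
  \<open>Card_order \<mu>\<close>, and a family of \<open>\<mu>\<close> elements is one indexed by \<open>Field \<mu>\<close>.
  Over a nonzero ring a basis family is injective, so \<open>free_module_on_card\<close> then provides a
  basis with exactly \<open>\<mu>\<close> elements. Generating families may have repetitions.
\<close>

definition generated_by_card ::
    "('a, 'r) ring_scheme \<Rightarrow> ('a, 'b, 'm) module_scheme \<Rightarrow> 'i rel \<Rightarrow> bool" where
  "generated_by_card R M \<mu> \<longleftrightarrow> (\<exists>g. generating_family R M (Field \<mu>) g)"

definition free_module_on_card ::
    "('a, 'r) ring_scheme \<Rightarrow> ('a, 'b, 'm) module_scheme \<Rightarrow> 'i rel \<Rightarrow> bool" where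
  "free_module_on_card R M \<mu> \<longleftrightarrow> (\<exists>e. basis_family R M (Field \<mu>) e)"

end

theory Submission
  imports Defs
begin

text \<open>
  Let \<open>g\<close> be a family of generators of \<open>M\<close> indexed by \<open>I\<close>, and \<open>\<phi>\<close> a lift of \<open>R\<close> defined on the ring
  \<open>Rh\<close>. The lift of \<open>M\<close> is the free \<open>Rh\<close>-module on \<open>I\<close>, realised as the finitely supported functions
  \<open>I \<rightarrow> Rh\<close>, with the map \<open>\<psi> f = (\<Sum>i. \<phi> (f i) g\<^sub>i)\<close>, which applies \<open>\<phi>\<close> to the coordinates of a formal
  combination and evaluates the result at the generators.

  The map \<open>\<phi>\<close> respects sums and products, and reaches the elements of \<open>R\<close>, only up to the surpassing
  relation, so what has to be seen is that surpassing survives the evaluation. It does, for two reasons. If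
  \<open>a\<close> surpasses \<open>b\<close> in \<open>R\<close>, then \<open>a x\<close> surpasses \<open>b x\<close> in \<open>M\<close>, since \<open>(c + (-)c) x = c x + (-)(c x)\<close>
  (\<open>surpasses_smult_left\<close>). And since \<open>M\<degree>\<close> is closed under addition, surpassing may be checked
  termwise in a finite sum (\<open>surpasses_finsum\<close>). Hence each of the lift conditions for \<open>\<psi>\<close> follows
  from the corresponding condition on \<open>\<phi>\<close>, used at each coordinate; for density, a combination
  \<open>\<Sum> c\<^sub>i g\<^sub>i\<close> surpasses \<open>\<psi> f\<close> as soon as \<open>c\<^sub>i\<close> surpasses \<open>\<phi> (f i)\<close> for each \<open>i\<close>.

  Both claims are instances: take \<open>g\<close> to be a given generating family for the second one, and the
  family of all elements of \<open>M\<close> for the first one.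
\<close>

section \<open>Surpassing in modules over a semiring with negation\<close>

locale semimodule_negation = semimodule R M + semiring_negation R neg
  for R (structure) and M (structure) and neg
begin

abbreviation mneg where "mneg \<equiv> induced_neg R neg M"

lemma neg_smult:
  assumes "a \<in> carrier R" "x \<in> carrier M"
  shows "neg a \<odot>\<^bsub>M\<^esub> x = mneg (a \<odot>\<^bsub>M\<^esub> x)"
proof -
  have "neg a = neg \<one> \<otimes> a"
    using neg_mult_l[of \<one> a] assms by simp
  then show ?thesis
    using assms by (simp add: induced_neg_def smult_assoc neg_closed)
qed

lemma mneg_closed: "x \<in> carrier M \<Longrightarrow> mneg x \<in> carrier M"
  by (simp add: induced_neg_def smult_closed neg_closed)

lemma mneg_add:
  "x \<in> carrier M \<Longrightarrow> y \<in> carrier M \<Longrightarrow> mneg (x \<oplus>\<^bsub>M\<^esub> y) = mneg x \<oplus>\<^bsub>M\<^esub> mneg y"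
  by (simp add: induced_neg_def smult_r_distr neg_closed)

lemma circ_closed: "x \<in> circ M mneg \<Longrightarrow> x \<in> carrier M"
  by (auto simp: circ_def mneg_closed)

lemma zero_in_circ: "\<zero>\<^bsub>M\<^esub> \<in> circ M mneg"
  unfolding circ_def
  by (rule CollectI, rule exI[of _ "\<zero>\<^bsub>M\<^esub>"]) (simp add: induced_neg_def smult_zero_r neg_closed)

lemma add_in_circ:
  assumes "x \<in> circ M mneg" "y \<in> circ M mneg"
  shows "x \<oplus>\<^bsub>M\<^esub> y \<in> circ M mneg"
proof -
  obtain u v where u: "u \<in> carrier M" "x = u \<oplus>\<^bsub>M\<^esub> mneg u"
    and v: "v \<in> carrier M" "y = v \<oplus>\<^bsub>M\<^esub> mneg v"
    using assms by (auto simp: circ_def)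
  then have "x \<oplus>\<^bsub>M\<^esub> y = (u \<oplus>\<^bsub>M\<^esub> v) \<oplus>\<^bsub>M\<^esub> mneg (u \<oplus>\<^bsub>M\<^esub> v)"
    by (simp add: mneg_add mneg_closed M.add.m_ac)
  then show ?thesis
    using u v unfolding circ_def by blast
qed

lemma surpasses_smult_left:
  assumes "surpasses R neg a b" "b \<in> carrier R" "x \<in> carrier M"
  shows "surpasses M mneg (a \<odot>\<^bsub>M\<^esub> x) (b \<odot>\<^bsub>M\<^esub> x)"
proof -
  obtain c where c: "c \<in> carrier R" "a = b \<oplus> (c \<oplus> neg c)"
    using assms(1) by (auto simp: surpasses_def circ_def)
  then have "a \<odot>\<^bsub>M\<^esub> x = b \<odot>\<^bsub>M\<^esub> x \<oplus>\<^bsub>M\<^esub> (c \<odot>\<^bsub>M\<^esub> x \<oplus>\<^bsub>M\<^esub> mneg (c \<odot>\<^bsub>M\<^esub> x))"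
    using assms by (simp add: smult_l_distr neg_closed neg_smult)
  then show ?thesis
    using c assms smult_closed unfolding surpasses_def circ_def by blast
qed

lemma surpasses_refl: "x \<in> carrier M \<Longrightarrow> surpasses M mneg x x"
  unfolding surpasses_def by (rule bexI[OF _ zero_in_circ]) simp

lemma surpasses_add:
  assumes "surpasses M mneg x y" "surpasses M mneg x' y'" "y \<in> carrier M" "y' \<in> carrier M"
  shows "surpasses M mneg (x \<oplus>\<^bsub>M\<^esub> x') (y \<oplus>\<^bsub>M\<^esub> y')"
proof -
  obtain z z' where z: "z \<in> circ M mneg" "z' \<in> circ M mneg"
    and eq: "x = y \<oplus>\<^bsub>M\<^esub> z" "x' = y' \<oplus>\<^bsub>M\<^esub> z'"
    using assms by (auto simp: surpasses_def)
  have "x \<oplus>\<^bsub>M\<^esub> x' = (y \<oplus>\<^bsub>M\<^esub> y') \<oplus>\<^bsub>M\<^esub> (z \<oplus>\<^bsub>M\<^esub> z')"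
    using z assms eq by (simp add: circ_closed M.add.m_ac)
  then show ?thesis
    using z add_in_circ unfolding surpasses_def by blast
qed

lemma surpasses_finsum:
  assumes "finite A"
    and "\<And>i. i \<in> A \<Longrightarrow> x i \<in> carrier M"
    and "\<And>i. i \<in> A \<Longrightarrow> y i \<in> carrier M"
    and "\<And>i. i \<in> A \<Longrightarrow> surpasses M mneg (x i) (y i)"
  shows "surpasses M mneg (\<Oplus>\<^bsub>M\<^esub>i\<in>A. x i) (\<Oplus>\<^bsub>M\<^esub>i\<in>A. y i)"
  using assms
proof (induction A rule: finite_induct)
  case empty
  show ?case by (simp add: surpasses_refl)
next
  case (insert j A)
  have "x \<in> A \<rightarrow> carrier M" "y \<in> A \<rightarrow> carrier M"
    using insert.prems by auto
  then show ?case
    using insert by (simp add: surpasses_add M.finsum_closed)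
qed

lemma smult_finsum:
  assumes "finite A" "a \<in> carrier R" "x \<in> A \<rightarrow> carrier M"
  shows "a \<odot>\<^bsub>M\<^esub> (\<Oplus>\<^bsub>M\<^esub>i\<in>A. x i) = (\<Oplus>\<^bsub>M\<^esub>i\<in>A. a \<odot>\<^bsub>M\<^esub> x i)"
  using assms
proof (induction A rule: finite_induct)
  case empty
  then show ?case by (simp add: smult_zero_r)
next
  case (insert j A)
  have "x \<in> A \<rightarrow> carrier M" "x j \<in> carrier M" "(\<lambda>i. a \<odot>\<^bsub>M\<^esub> x i) \<in> A \<rightarrow> carrier M"
    using insert.prems by (auto simp: Pi_iff smult_closed)
  then show ?case
    using insert by (simp add: smult_r_distr smult_closed M.finsum_closed)
qed

end

section \<open>The free module of finitely supported functions\<close>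

text \<open>
  The carrier consists of functions on the whole index type that vanish outside \<open>I\<close>, so that equality
  in the module is equality of functions.
\<close>

definition finsupp_module :: "('h, 's) ring_scheme \<Rightarrow> 'i set \<Rightarrow> ('h, 'i \<Rightarrow> 'h) module" where
  "finsupp_module S I =
     \<lparr>carrier = {f. (\<forall>i. f i \<in> carrier S) \<and> finite {i. f i \<noteq> \<zero>\<^bsub>S\<^esub>} \<and> {i. f i \<noteq> \<zero>\<^bsub>S\<^esub>} \<subseteq> I},
      monoid.mult = (\<lambda>f g i. \<zero>\<^bsub>S\<^esub>), one = (\<lambda>i. \<zero>\<^bsub>S\<^esub>),
      ring.zero = (\<lambda>i. \<zero>\<^bsub>S\<^esub>), ring.add = (\<lambda>f g i. f i \<oplus>\<^bsub>S\<^esub> g i),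
      smult = (\<lambda>a f i. a \<otimes>\<^bsub>S\<^esub> f i)\<rparr>"

definition unit_fun :: "('h, 's) ring_scheme \<Rightarrow> 'i \<Rightarrow> 'i \<Rightarrow> 'h" where
  "unit_fun S i = (\<lambda>j. if j = i then \<one>\<^bsub>S\<^esub> else \<zero>\<^bsub>S\<^esub>)"

lemma finsupp_module_simps:
  "f \<in> carrier (finsupp_module S I) \<longleftrightarrow>
     (\<forall>i. f i \<in> carrier S) \<and> finite {i. f i \<noteq> \<zero>\<^bsub>S\<^esub>} \<and> {i. f i \<noteq> \<zero>\<^bsub>S\<^esub>} \<subseteq> I"
  "\<zero>\<^bsub>finsupp_module S I\<^esub> = (\<lambda>i. \<zero>\<^bsub>S\<^esub>)"
  "f \<oplus>\<^bsub>finsupp_module S I\<^esub> g = (\<lambda>i. f i \<oplus>\<^bsub>S\<^esub> g i)"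
  "a \<odot>\<^bsub>finsupp_module S I\<^esub> f = (\<lambda>i. a \<otimes>\<^bsub>S\<^esub> f i)"
  by (simp_all add: finsupp_module_def)

context semiring
begin

lemma finsupp_add_closed:
  assumes "f \<in> carrier (finsupp_module R I)" "g \<in> carrier (finsupp_module R I)"
  shows "(\<lambda>i. f i \<oplus> g i) \<in> carrier (finsupp_module R I)"
proof -
  have "{i. f i \<oplus> g i \<noteq> \<zero>} \<subseteq> {i. f i \<noteq> \<zero>} \<union> {i. g i \<noteq> \<zero>}"
    by auto
  then show ?thesis
    using assms by (auto simp: finsupp_module_simps intro: finite_subset)
qed

lemma finsupp_smult_closed:
  assumes "a \<in> carrier R" "f \<in> carrier (finsupp_module R I)"
  shows "(\<lambda>i. a \<otimes> f i) \<in> carrier (finsupp_module R I)"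
proof -
  have "{i. a \<otimes> f i \<noteq> \<zero>} \<subseteq> {i. f i \<noteq> \<zero>}"
    using assms by auto
  then show ?thesis
    using assms by (auto simp: finsupp_module_simps intro: finite_subset)
qed

lemma semimodule_finsupp_module: "semimodule R (finsupp_module R I)"
proof -
  have "abelian_monoid (finsupp_module R I)"
  proof (rule abelian_monoidI)
    fix f g
    assume "f \<in> carrier (finsupp_module R I)" "g \<in> carrier (finsupp_module R I)"
    then show "f \<oplus>\<^bsub>finsupp_module R I\<^esub> g \<in> carrier (finsupp_module R I)"
      using finsupp_add_closed[of f I g] by (simp add: finsupp_module_simps(3))
  qed (auto simp: finsupp_module_simps add.m_ac)
  moreover have "a \<odot>\<^bsub>finsupp_module R I\<^esub> f \<in> carrier (finsupp_module R I)"
    if "a \<in> carrier R" "f \<in> carrier (finsupp_module R I)" for a f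
    using finsupp_smult_closed[OF that] by (simp add: finsupp_module_simps(4))
  ultimately show ?thesis
    by (intro semimodule.intro semimodule_axioms.intro semiring_axioms)
       (auto simp: finsupp_module_simps l_distr r_distr m_assoc)
qed

lemma unit_fun_closed: "i \<in> I \<Longrightarrow> unit_fun R i \<in> carrier (finsupp_module R I)"
  by (auto simp: finsupp_module_simps unit_fun_def)

lemma finsum_unit_fun:
  assumes "finite A" "A \<subseteq> I" "c \<in> A \<rightarrow> carrier R"
  shows "(\<Oplus>\<^bsub>finsupp_module R I\<^esub>i\<in>A. c i \<odot>\<^bsub>finsupp_module R I\<^esub> unit_fun R i)
    = (\<lambda>j. if j \<in> A then c j else \<zero>)"
proof -
  interpret F: semimodule R "finsupp_module R I"
    by (rule semimodule_finsupp_module)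
  show ?thesis
    using assms
  proof (induction A rule: finite_induct)
    case empty
    show ?case by (simp add: finsupp_module_simps)
  next
    case (insert k A)
    have closed: "c i \<odot>\<^bsub>finsupp_module R I\<^esub> unit_fun R i \<in> carrier (finsupp_module R I)"
      if "i \<in> insert k A" for i
      using that insert.prems by (intro F.smult_closed unit_fun_closed) auto
    have "(\<Oplus>\<^bsub>finsupp_module R I\<^esub>i\<in>insert k A. c i \<odot>\<^bsub>finsupp_module R I\<^esub> unit_fun R i)
        = c k \<odot>\<^bsub>finsupp_module R I\<^esub> unit_fun R k \<oplus>\<^bsub>finsupp_module R I\<^esub>
          (\<Oplus>\<^bsub>finsupp_module R I\<^esub>i\<in>A. c i \<odot>\<^bsub>finsupp_module R I\<^esub> unit_fun R i)"
      using insert.hyps closed by (intro F.M.finsum_insert) auto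
    also have "\<dots> = c k \<odot>\<^bsub>finsupp_module R I\<^esub> unit_fun R k \<oplus>\<^bsub>finsupp_module R I\<^esub>
          (\<lambda>j. if j \<in> A then c j else \<zero>)"
      using insert by simp
    also have "\<dots> = (\<lambda>j. if j \<in> insert k A then c j else \<zero>)"
      using insert.hyps insert.prems
      by (auto simp: finsupp_module_simps unit_fun_def fun_eq_iff Pi_iff)
    finally show ?case .
  qed
qed

lemma basis_family_unit_fun: "basis_family R (finsupp_module R I) I (unit_fun R)"
proof -
  have "\<exists>A c. finite A \<and> A \<subseteq> I \<and> c \<in> A \<rightarrow> carrier R \<and>
      f = (\<Oplus>\<^bsub>finsupp_module R I\<^esub>i\<in>A. c i \<odot>\<^bsub>finsupp_module R I\<^esub> unit_fun R i)"
    if f: "f \<in> carrier (finsupp_module R I)" for f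
  proof (intro exI conjI)
    let ?A = "{i. f i \<noteq> \<zero>}"
    show A: "finite ?A" "?A \<subseteq> I" "f \<in> ?A \<rightarrow> carrier R"
      using f by (auto simp: finsupp_module_simps)
    show "f = (\<Oplus>\<^bsub>finsupp_module R I\<^esub>i\<in>?A. f i \<odot>\<^bsub>finsupp_module R I\<^esub> unit_fun R i)"
      by (simp add: finsum_unit_fun[OF A] fun_eq_iff)
  qed
  moreover have "\<forall>i\<in>A. c i = \<zero>"
    if A: "finite A" "A \<subseteq> I" "c \<in> A \<rightarrow> carrier R"
      and eq: "(\<Oplus>\<^bsub>finsupp_module R I\<^esub>i\<in>A. c i \<odot>\<^bsub>finsupp_module R I\<^esub> unit_fun R i)
        = \<zero>\<^bsub>finsupp_module R I\<^esub>" for A c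
    using eq unfolding finsum_unit_fun[OF A]
    by (auto simp: finsupp_module_simps fun_eq_iff split: if_splits)
  ultimately show ?thesis
    unfolding basis_family_def generating_family_def independent_family_def
    by (auto intro: unit_fun_closed)
qed

end

text \<open>Passing from a family to the set of its members is a reindexing of the sums involved.\<close>

lemma free_module_if_inj_basis:
  assumes "semimodule S N" "basis_family S N I e" "inj_on e I"
  shows "free_module S N"
proof -
  interpret semimodule S N by fact
  have e: "e i \<in> carrier N" if "i \<in> I" for i
    using assms(2) that by (auto simp: basis_family_def generating_family_def)
  have reindex: "(\<Oplus>\<^bsub>N\<^esub>b\<in>e ` A. c b \<odot>\<^bsub>N\<^esub> b) = (\<Oplus>\<^bsub>N\<^esub>i\<in>A. c (e i) \<odot>\<^bsub>N\<^esub> e i)"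
    if "A \<subseteq> I" "c \<in> e ` A \<rightarrow> carrier S" for A c
    using that e by (intro M.finsum_reindex inj_on_subset[OF assms(3)]) (auto intro!: smult_closed)
  have "basis_family S N (e ` I) (\<lambda>b. b)"
    unfolding basis_family_def generating_family_def independent_family_def
  proof (intro conjI ballI allI impI)
    show "(\<lambda>b. b) \<in> e ` I \<rightarrow> carrier N" "(\<lambda>b. b) \<in> e ` I \<rightarrow> carrier N"
      using e by auto
  next
    fix x assume "x \<in> carrier N"
    then obtain A c where A: "finite A" "A \<subseteq> I" "c \<in> A \<rightarrow> carrier S"
      and x: "x = (\<Oplus>\<^bsub>N\<^esub>i\<in>A. c i \<odot>\<^bsub>N\<^esub> e i)"
      using assms(2) unfolding basis_family_def generating_family_def by blast
    let ?d = "\<lambda>b. c (inv_into I e b)"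
    have d: "?d (e i) = c i" if "i \<in> A" for i
      using that A(2) assms(3) by (auto simp: inv_into_f_f)
    have "(\<Oplus>\<^bsub>N\<^esub>i\<in>A. c i \<odot>\<^bsub>N\<^esub> e i) = (\<Oplus>\<^bsub>N\<^esub>i\<in>A. ?d (e i) \<odot>\<^bsub>N\<^esub> e i)"
      using A e by (intro M.finsum_cong') (auto simp: d intro!: smult_closed)
    then have "x = (\<Oplus>\<^bsub>N\<^esub>b\<in>e ` A. ?d b \<odot>\<^bsub>N\<^esub> b)"
      using A x d by (subst reindex) auto
    then show "\<exists>B c. finite B \<and> B \<subseteq> e ` I \<and> c \<in> B \<rightarrow> carrier S \<and> x = (\<Oplus>\<^bsub>N\<^esub>b\<in>B. c b \<odot>\<^bsub>N\<^esub> b)"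
      using A d by (intro exI[of _ "e ` A"] exI[of _ ?d]) auto
  next
    fix B c b
    assume B: "finite B \<and> B \<subseteq> e ` I \<and> c \<in> B \<rightarrow> carrier S \<and> (\<Oplus>\<^bsub>N\<^esub>b\<in>B. c b \<odot>\<^bsub>N\<^esub> b) = \<zero>\<^bsub>N\<^esub>"
      and b: "b \<in> B"
    then obtain A where A: "finite A" "A \<subseteq> I" "B = e ` A"
      by (meson finite_subset_image)
    with B have "(\<Oplus>\<^bsub>N\<^esub>i\<in>A. c (e i) \<odot>\<^bsub>N\<^esub> e i) = \<zero>\<^bsub>N\<^esub>"
      using reindex[of A c] by simp
    moreover have "(\<lambda>i. c (e i)) \<in> A \<rightarrow> carrier S"
      using A B by auto
    ultimately have "\<forall>i\<in>A. c (e i) = \<zero>\<^bsub>S\<^esub>"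
      using assms(2) A unfolding basis_family_def independent_family_def by blast
    then show "c b = \<zero>\<^bsub>S\<^esub>"
      using A(3) b by blast
  qed
  then show ?thesis
    unfolding free_module_def by blast
qed

text \<open>
  Over a nonzero ring the unit functions are distinct. Over the zero ring they all coincide, but then
  the module is zero as well, and the empty set is a basis.
\<close>

lemma (in semiring) free_module_finsupp_module: "free_module R (finsupp_module R I)"
proof (cases "\<one> = \<zero>")
  case True
  have zero: "a = \<zero>" if "a \<in> carrier R" for a
    using l_one[OF that] l_null[OF that] True by simp
  have "basis_family R (finsupp_module R {}) {} (unit_fun R)"
    by (rule basis_family_unit_fun)
  moreover have "finsupp_module R I = finsupp_module R {}"
    using zero by (force simp: finsupp_module_def)
  ultimately show ?thesis
    using free_module_if_inj_basis[OF semimodule_finsupp_module, of "{}" "{}" "unit_fun R"] by simp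
next
  case False
  then have "inj_on (unit_fun R) I"
    by (auto simp: inj_on_def unit_fun_def fun_eq_iff)
  then show ?thesis
    using free_module_if_inj_basis[OF semimodule_finsupp_module basis_family_unit_fun] by blast
qed

section \<open>Lifting a module along a generating family\<close>

definition lift_eval ::
    "('h, 's) ring_scheme \<Rightarrow> ('h \<Rightarrow> 'a) \<Rightarrow> ('a, 'b, 'm) module_scheme \<Rightarrow> ('i \<Rightarrow> 'b) \<Rightarrow> ('i \<Rightarrow> 'h) \<Rightarrow> 'b"
  where "lift_eval S \<phi> M g f = (\<Oplus>\<^bsub>M\<^esub>i\<in>{i. f i \<noteq> \<zero>\<^bsub>S\<^esub>}. \<phi> (f i) \<odot>\<^bsub>M\<^esub> g i)"

lemma (in semimodule_negation) module_lift_finsupp_module: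
  assumes lift: "semiring_lift R neg Rh \<phi>" and gen: "generating_family R M I g"
  shows "module_lift R neg Rh \<phi> M (finsupp_module Rh I) (lift_eval Rh \<phi> M g)"
proof -
  interpret Rh: ring Rh
    using lift by (simp add: semiring_lift_def)
  interpret F: semimodule Rh "finsupp_module Rh I"
    by (rule Rh.semimodule_finsupp_module)
  let ?F = "finsupp_module Rh I" and ?\<psi> = "lift_eval Rh \<phi> M g"
  let ?supp = "\<lambda>f. {i. f i \<noteq> \<zero>\<^bsub>Rh\<^esub>}"
  have \<phi>_closed: "\<phi> a \<in> carrier R" if "a \<in> carrier Rh" for a
    using lift that by (auto simp: semiring_lift_def surpass_morphism_def)
  have \<phi>_add: "surpasses R neg (\<phi> a \<oplus> \<phi> b) (\<phi> (a \<oplus>\<^bsub>Rh\<^esub> b))"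
    and \<phi>_mult: "surpasses R neg (\<phi> a \<otimes> \<phi> b) (\<phi> (a \<otimes>\<^bsub>Rh\<^esub> b))"
    if "a \<in> carrier Rh" "b \<in> carrier Rh" for a b
    using lift that by (auto simp: semiring_lift_def surpass_morphism_def)
  have \<phi>_zero: "\<phi> \<zero>\<^bsub>Rh\<^esub> = \<zero>"
    using lift by (simp add: semiring_lift_def surpass_morphism_def)
  have g: "g i \<in> carrier M" if "i \<in> I" for i
    using gen that by (auto simp: generating_family_def)
  have term_closed: "\<phi> (f i) \<odot>\<^bsub>M\<^esub> g i \<in> carrier M" if "f i \<in> carrier Rh" "i \<in> I" for f i
    using that by (intro smult_closed \<phi>_closed g)
  have fD: "f i \<in> carrier Rh" "finite (?supp f)" "?supp f \<subseteq> I" if "f \<in> carrier ?F" for f i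
    using that by (auto simp: finsupp_module_simps)
  \<comment> \<open>Comparing values of \<open>\<psi>\<close> requires sums over a common index set, so the support may be enlarged.\<close>
  have \<psi>_eq: "?\<psi> f = (\<Oplus>\<^bsub>M\<^esub>i\<in>A. \<phi> (f i) \<odot>\<^bsub>M\<^esub> g i)"
    if "f \<in> carrier ?F" "finite A" "A \<subseteq> I" "?supp f \<subseteq> A" for f A
    unfolding lift_eval_def
    by (rule M.add.finprod_mono_neutral_cong_left)
       (use that in \<open>auto simp: \<phi>_zero fD(1) intro!: term_closed smult_zero_l g\<close>)
  have \<psi>_closed: "?\<psi> f \<in> carrier M" if "f \<in> carrier ?F" for f
    unfolding lift_eval_def using fD[OF that] by (intro M.finsum_closed) (auto intro!: term_closed)
  have add: "surpasses M mneg (?\<psi> f \<oplus>\<^bsub>M\<^esub> ?\<psi> h) (?\<psi> (f \<oplus>\<^bsub>?F\<^esub> h))"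
    if f: "f \<in> carrier ?F" and h: "h \<in> carrier ?F" for f h
  proof -
    let ?A = "?supp f \<union> ?supp h"
    have A: "finite ?A" "?A \<subseteq> I"
      using fD[OF f] fD[OF h] by auto
    have fh: "f \<oplus>\<^bsub>?F\<^esub> h \<in> carrier ?F"
      using f h by (rule F.M.a_closed)
    have supp: "?supp (f \<oplus>\<^bsub>?F\<^esub> h) \<subseteq> ?A"
      by (auto simp: finsupp_module_simps)
    have "?\<psi> f \<oplus>\<^bsub>M\<^esub> ?\<psi> h = (\<Oplus>\<^bsub>M\<^esub>i\<in>?A. \<phi> (f i) \<odot>\<^bsub>M\<^esub> g i) \<oplus>\<^bsub>M\<^esub> (\<Oplus>\<^bsub>M\<^esub>i\<in>?A. \<phi> (h i) \<odot>\<^bsub>M\<^esub> g i)"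
      using \<psi>_eq[OF f A] \<psi>_eq[OF h A] by simp
    also have "\<dots> = (\<Oplus>\<^bsub>M\<^esub>i\<in>?A. \<phi> (f i) \<odot>\<^bsub>M\<^esub> g i \<oplus>\<^bsub>M\<^esub> \<phi> (h i) \<odot>\<^bsub>M\<^esub> g i)"
      using A f h by (intro M.finsum_addf[symmetric]) (auto intro!: term_closed fD(1))
    also have "\<dots> = (\<Oplus>\<^bsub>M\<^esub>i\<in>?A. (\<phi> (f i) \<oplus> \<phi> (h i)) \<odot>\<^bsub>M\<^esub> g i)"
      using A f h
      by (intro M.finsum_cong') (auto simp: smult_l_distr \<phi>_closed fD(1) g subsetD intro!: smult_closed)
    finally have left: "?\<psi> f \<oplus>\<^bsub>M\<^esub> ?\<psi> h = (\<Oplus>\<^bsub>M\<^esub>i\<in>?A. (\<phi> (f i) \<oplus> \<phi> (h i)) \<odot>\<^bsub>M\<^esub> g i)" .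
    have "surpasses M mneg ((\<phi> (f i) \<oplus> \<phi> (h i)) \<odot>\<^bsub>M\<^esub> g i) (\<phi> ((f \<oplus>\<^bsub>?F\<^esub> h) i) \<odot>\<^bsub>M\<^esub> g i)"
      if "i \<in> ?A" for i
      using that A \<phi>_add[OF fD(1)[OF f, of i] fD(1)[OF h, of i]] fD(1)[OF fh, of i]
      by (intro surpasses_smult_left) (auto simp: finsupp_module_simps \<phi>_closed g)
    then show ?thesis
      unfolding left \<psi>_eq[OF fh A supp] using A f h fh
      by (intro surpasses_finsum) (auto intro!: smult_closed \<phi>_closed fD(1) g)
  qed
  have smult: "surpasses M mneg (\<phi> a \<odot>\<^bsub>M\<^esub> ?\<psi> f) (?\<psi> (a \<odot>\<^bsub>?F\<^esub> f))"
    if a: "a \<in> carrier Rh" and f: "f \<in> carrier ?F" for a f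
  proof -
    let ?A = "?supp f"
    have A: "finite ?A" "?A \<subseteq> I"
      using fD[OF f] by auto
    have af: "a \<odot>\<^bsub>?F\<^esub> f \<in> carrier ?F"
      using a f by (rule F.smult_closed)
    have supp: "?supp (a \<odot>\<^bsub>?F\<^esub> f) \<subseteq> ?A"
      using a by (auto simp: finsupp_module_simps)
    have "\<phi> a \<odot>\<^bsub>M\<^esub> ?\<psi> f = (\<Oplus>\<^bsub>M\<^esub>i\<in>?A. \<phi> a \<odot>\<^bsub>M\<^esub> (\<phi> (f i) \<odot>\<^bsub>M\<^esub> g i))"
      unfolding lift_eval_def using A a f
      by (intro smult_finsum) (auto intro!: term_closed fD(1) \<phi>_closed)
    also have "\<dots> = (\<Oplus>\<^bsub>M\<^esub>i\<in>?A. (\<phi> a \<otimes> \<phi> (f i)) \<odot>\<^bsub>M\<^esub> g i)"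
      using A a f
      by (intro M.finsum_cong') (auto simp: smult_assoc \<phi>_closed fD(1) g subsetD intro!: smult_closed)
    finally have left: "\<phi> a \<odot>\<^bsub>M\<^esub> ?\<psi> f = (\<Oplus>\<^bsub>M\<^esub>i\<in>?A. (\<phi> a \<otimes> \<phi> (f i)) \<odot>\<^bsub>M\<^esub> g i)" .
    have "surpasses M mneg ((\<phi> a \<otimes> \<phi> (f i)) \<odot>\<^bsub>M\<^esub> g i) (\<phi> ((a \<odot>\<^bsub>?F\<^esub> f) i) \<odot>\<^bsub>M\<^esub> g i)"
      if "i \<in> ?A" for i
      using that A \<phi>_mult[OF a fD(1)[OF f, of i]] fD(1)[OF af, of i]
      by (intro surpasses_smult_left) (auto simp: finsupp_module_simps \<phi>_closed g)
    then show ?thesis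
      unfolding left \<psi>_eq[OF af A supp] using A a f af
      by (intro surpasses_finsum) (auto intro!: smult_closed \<phi>_closed fD(1) g)
  qed
  have dense: "\<exists>f \<in> carrier ?F. surpasses M mneg x (?\<psi> f)" if "x \<in> carrier M" for x
  proof -
    obtain A c where A: "finite A" "A \<subseteq> I" and c: "c \<in> A \<rightarrow> carrier R"
      and x: "x = (\<Oplus>\<^bsub>M\<^esub>i\<in>A. c i \<odot>\<^bsub>M\<^esub> g i)"
      using gen \<open>x \<in> carrier M\<close> unfolding generating_family_def by blast
    have "\<forall>i\<in>A. \<exists>a. a \<in> carrier Rh \<and> surpasses R neg (c i) (\<phi> a)"
      using c lift by (auto simp: semiring_lift_def surpass_dense_def)
    then obtain r where r: "\<And>i. i \<in> A \<Longrightarrow> r i \<in> carrier Rh \<and> surpasses R neg (c i) (\<phi> (r i))"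
      by metis
    define f where "f = (\<lambda>i. if i \<in> A then r i else \<zero>\<^bsub>Rh\<^esub>)"
    have supp: "?supp f \<subseteq> A"
      by (auto simp: f_def)
    then have f: "f \<in> carrier ?F"
      using A r finite_subset[OF supp] by (auto simp: finsupp_module_simps f_def)
    have "surpasses M mneg (c i \<odot>\<^bsub>M\<^esub> g i) (\<phi> (f i) \<odot>\<^bsub>M\<^esub> g i)" if "i \<in> A" for i
      using that r[OF that] A by (intro surpasses_smult_left) (auto simp: f_def \<phi>_closed g)
    then have "surpasses M mneg x (?\<psi> f)"
      unfolding x \<psi>_eq[OF f A supp] using A c f
      by (intro surpasses_finsum) (auto intro!: smult_closed \<phi>_closed fD(1) g)
    with f show ?thesis by blast
  qed
  show ?thesis
    unfolding module_lift_def surpass_dense_def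
    using F.semimodule_axioms \<psi>_closed add smult dense
    by (auto simp: lift_eval_def finsupp_module_simps(2))
qed

lemma (in semimodule) generating_family_carrier: "generating_family R M (carrier M) (\<lambda>x. x)"
proof -
  have "x = (\<Oplus>\<^bsub>M\<^esub>i\<in>{x}. \<one> \<odot>\<^bsub>M\<^esub> i)" if "x \<in> carrier M" for x
    using that by (simp add: smult_one)
  then show ?thesis
    unfolding generating_family_def
    by (intro conjI ballI) (simp, rule exI[of _ "{_}"], rule exI[of _ "\<lambda>_. \<one>"], auto)
qed

theorem theorem2p34:
  fixes R :: "('a, 'r) ring_scheme" and neg :: "'a \<Rightarrow> 'a"
  assumes "semiring_negation R neg"
    and "\<exists>(Rh :: 'h ring) \<phi>. semiring_lift R neg Rh \<phi>"
  shows "(\<forall>M :: ('a, 'm) module. semimodule R M \<longrightarrow>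
            (\<exists>(Rh :: 'h ring) \<phi> (Mh :: ('h, 'm \<Rightarrow> 'h) module) \<psi>.
               semiring_lift R neg Rh \<phi> \<and>
               module_lift R neg Rh \<phi> M Mh \<psi> \<and>
               free_module Rh Mh)) \<and>
         (\<forall>(M :: ('a, 'm) module) (\<mu> :: 'i rel).
            semimodule R M \<and> Card_order \<mu> \<and> generated_by_card R M \<mu> \<longrightarrow>
            (\<exists>(Rh :: 'h ring) \<phi> (Mh :: ('h, 'i \<Rightarrow> 'h) module) \<psi>.
               semiring_lift R neg Rh \<phi> \<and>
               module_lift R neg Rh \<phi> M Mh \<psi> \<and>
               free_module_on_card Rh Mh \<mu>))"
proof -
  obtain Rh :: "'h ring" and \<phi> where lift: "semiring_lift R neg Rh \<phi>"
    using assms(2) by blast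
  interpret Rh: ring Rh
    using lift by (simp add: semiring_lift_def)
  have sn: "semimodule_negation R M neg" if "semimodule R M" for M :: "('a, 'm) module"
    using that assms(1) by (rule semimodule_negation.intro)
  show ?thesis
  proof (intro conjI allI impI)
    fix M :: "('a, 'm) module"
    assume M: "semimodule R M"
    have "module_lift R neg Rh \<phi> M (finsupp_module Rh (carrier M)) (lift_eval Rh \<phi> M (\<lambda>x. x))"
      by (rule semimodule_negation.module_lift_finsupp_module
          [OF sn[OF M] lift semimodule.generating_family_carrier[OF M]])
    then show "\<exists>(Rh :: 'h ring) \<phi> (Mh :: ('h, 'm \<Rightarrow> 'h) module) \<psi>.
        semiring_lift R neg Rh \<phi> \<and> module_lift R neg Rh \<phi> M Mh \<psi> \<and> free_module Rh Mh"
      using lift Rh.free_module_finsupp_module by blast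
  next
    fix M :: "('a, 'm) module" and \<mu> :: "'i rel"
    assume M: "semimodule R M \<and> Card_order \<mu> \<and> generated_by_card R M \<mu>"
    then obtain g where "generating_family R M (Field \<mu>) g"
      unfolding generated_by_card_def by blast
    then have "module_lift R neg Rh \<phi> M (finsupp_module Rh (Field \<mu>)) (lift_eval Rh \<phi> M g)"
      using M by (intro semimodule_negation.module_lift_finsupp_module[OF sn lift]) auto
    then show "\<exists>(Rh :: 'h ring) \<phi> (Mh :: ('h, 'i \<Rightarrow> 'h) module) \<psi>.
        semiring_lift R neg Rh \<phi> \<and> module_lift R neg Rh \<phi> M Mh \<psi> \<and> free_module_on_card Rh Mh \<mu>"
      using lift Rh.basis_family_unit_fun unfolding free_module_on_card_def by blast
  qed
qed

end
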